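(* The cone $C^n_{r_1r_2}=\mathrm{Cone}(v_{T^\pm}: T^\pm\text{ is a semi-standard linked pair})$ is a finitely generated cone, and $$C^n_{r_1r_2}\cap M=\{v_{T^\pm}: T^\pm\text{ is a semi-standard linked pair}\}.$$
   Context: Fix positive integers $r_1,r_2,n$, and let $M=\mathrm{Mat}(r_2\times r_1,\mathbb{Z})^n\cong\mathbb{Z}^{nr_1r_2}$. A linked tableaux pair $T^\pm=(T^+,T^-)$ consists, for some $a\in\frac1{\gcd(r_1,r_2)}\mathbb{Z}_{\ge0}$, of a filling $T^-$ of the rectangle with $r_1$ rows and $ar_2$ columns by double labels $ij$ ($1\le i\le n$, $1\le j\le r_2$), and a filling $T^+$ of the rectangle with $r_2$ rows and $ar_1$ columns by double labels $ij$ ($1\le i\le n$, $1\le j\le r_1$), such that there is a bijection (the link) from boxes of $T^-$ to boxes of $T^+$ taking each label $iq$ in row $p$ of $T^-$ to a label $ip$ in row $q$ of $T^+$. The empty pair ($a=0$) is allowed. Labels are ordered lexicographically. The pair is semi-standard if both $T^+$ and $T^-$ have weakly increasing rows and strictly increasing columns. With variables $x^i_{jk}$ ($1\le i\le n$, $1\le j\le r_2$, $1\le k\le r_1$), $\mathrm{Mon}(T^+)$ is the product over boxes of $T^+$ of $x^i_{kj}$ for a label $ij$ in row $k$. The vector $v_{T^\pm}=(v^i_{jk})\in M$ is the exponent vector of $\mathrm{Mon}(T^+)$, i.e. $v^i_{jk}$ is the number of labels $ik$ in row $j$ of $T^+$. $\mathrm{Cone}(S)$ is the set of nonnegative real linear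 combinations of elements of $S$ in $M\otimes\mathbb{R}$. *)

theory Defs
  imports Complex_Main
begin

text \<open>
  The ambient space: a vector \<open>v\<close> has coordinates \<open>v i j k\<close> with
  \<open>i \<in> {1..n}\<close>, \<open>j \<in> {1..r2}\<close>, \<open>k \<in> {1..r1}\<close>.  So that equality of vectors is equality of
  functions, coordinates outside this range are required to vanish.
\<close>

type_synonym coord_vec = "nat \<Rightarrow> nat \<Rightarrow> nat \<Rightarrow> real"

definition index_set :: "nat \<Rightarrow> nat \<Rightarrow> nat \<Rightarrow> (nat \<times> nat \<times> nat) set" where
  "index_set r1 r2 n = {1..n} \<times> {1..r2} \<times> {1..r1}"

definition real_space :: "nat \<Rightarrow> nat \<Rightarrow> nat \<Rightarrow> coord_vec set" where
  "real_space r1 r2 n = {v. \<forall>i j k. (i, j, k) \<notin> index_set r1 r2 n \<longrightarrow> v i j k = 0}"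

definition int_lattice :: "nat \<Rightarrow> nat \<Rightarrow> nat \<Rightarrow> coord_vec set" where
  "int_lattice r1 r2 n = {v \<in> real_space r1 r2 n. \<forall>i j k. v i j k \<in> \<int>}"

definition Cone :: "coord_vec set \<Rightarrow> coord_vec set" where
  "Cone S = {(\<lambda>i j k. \<Sum>s\<in>F. c s * s i j k) | F c. finite F \<and> F \<subseteq> S \<and> (\<forall>s\<in>F. 0 \<le> c s)}"

definition finitely_generated_cone :: "nat \<Rightarrow> nat \<Rightarrow> nat \<Rightarrow> coord_vec set \<Rightarrow> bool" where
  "finitely_generated_cone r1 r2 n C \<longleftrightarrow>
     (\<exists>F. finite F \<and> F \<subseteq> real_space r1 r2 n \<and> C = Cone F)"


text \<open>
  A filling assigns a label to each row and column (both counted from 1); only its values on the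
  boxes of the rectangle under consideration are relevant.
\<close>

type_synonym label = "nat \<times> nat"
type_synonym filling = "nat \<Rightarrow> nat \<Rightarrow> label"

definition boxes :: "nat \<Rightarrow> nat \<Rightarrow> (nat \<times> nat) set" where
  "boxes rows cols = {1..rows} \<times> {1..cols}"

definition labelled_by :: "label set \<Rightarrow> nat \<Rightarrow> nat \<Rightarrow> filling \<Rightarrow> bool" where
  "labelled_by L rows cols T \<longleftrightarrow> (\<forall>(p, c) \<in> boxes rows cols. T p c \<in> L)"

text \<open>
  The number of columns \<open>a r\<close>; rounding has no effect, since \<open>a r\<close> is a natural number whenever
  \<open>r \<in> {r1, r2}\<close> and \<open>a\<close> is a nonnegative integer multiple of \<open>1 / gcd r1 r2\<close>.
\<close>

definition width :: "rat \<Rightarrow> nat \<Rightarrow> nat" where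
  "width a r = nat \<lfloor>a * of_nat r\<rfloor>"

text \<open>The first filling is \<open>T\<^sup>-\<close>, the second one is \<open>T\<^sup>+\<close>.\<close>

definition linked_pair :: "nat \<Rightarrow> nat \<Rightarrow> nat \<Rightarrow> rat \<Rightarrow> filling \<Rightarrow> filling \<Rightarrow> bool" where
  "linked_pair r1 r2 n a Tm Tp \<longleftrightarrow>
     (\<exists>m :: nat. a = of_nat m / of_nat (gcd r1 r2)) \<and>
     labelled_by ({1..n} \<times> {1..r2}) r1 (width a r2) Tm \<and>
     labelled_by ({1..n} \<times> {1..r1}) r2 (width a r1) Tp \<and>
     (\<exists>f. bij_betw f (boxes r1 (width a r2)) (boxes r2 (width a r1)) \<and>
          (\<forall>p c i q. (p, c) \<in> boxes r1 (width a r2) \<and> Tm p c = (i, q) \<longrightarrow>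
             (\<exists>d. f (p, c) = (q, d) \<and> Tp q d = (i, p))))"

definition label_less :: "label \<Rightarrow> label \<Rightarrow> bool" where
  "label_less x y \<longleftrightarrow> (x, y) \<in> less_than <*lex*> less_than"

definition label_le :: "label \<Rightarrow> label \<Rightarrow> bool" where
  "label_le x y \<longleftrightarrow> x = y \<or> label_less x y"

definition semistandard :: "nat \<Rightarrow> nat \<Rightarrow> filling \<Rightarrow> bool" where
  "semistandard rows cols T \<longleftrightarrow>
     (\<forall>p c c'. (p, c) \<in> boxes rows cols \<and> (p, c') \<in> boxes rows cols \<and> c < c' \<longrightarrow>
        label_le (T p c) (T p c')) \<and>
     (\<forall>p p' c. (p, c) \<in> boxes rows cols \<and> (p', c) \<in> boxes rows cols \<and> p < p' \<longrightarrow>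
        label_less (T p c) (T p' c))"

definition semistandard_linked_pair ::
    "nat \<Rightarrow> nat \<Rightarrow> nat \<Rightarrow> rat \<Rightarrow> filling \<Rightarrow> filling \<Rightarrow> bool" where
  "semistandard_linked_pair r1 r2 n a Tm Tp \<longleftrightarrow>
     linked_pair r1 r2 n a Tm Tp \<and>
     semistandard r1 (width a r2) Tm \<and> semistandard r2 (width a r1) Tp"

text \<open>
  The exponent vector of \<open>Mon(T\<^sup>+)\<close>: each label \<open>(i, k)\<close> in row \<open>j\<close> of \<open>T\<^sup>+\<close> contributes a
  factor \<open>x\<^sup>i\<^bsub>jk\<^esub>\<close>.
\<close>

definition pair_vec :: "nat \<Rightarrow> nat \<Rightarrow> rat \<Rightarrow> filling \<Rightarrow> coord_vec" where
  "pair_vec r1 r2 a Tp =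
     (\<lambda>i j k. real (card {c. (j, c) \<in> boxes r2 (width a r1) \<and> Tp j c = (i, k)}))"

definition semistandard_vecs :: "nat \<Rightarrow> nat \<Rightarrow> nat \<Rightarrow> coord_vec set" where
  "semistandard_vecs r1 r2 n =
     {pair_vec r1 r2 a Tp | a Tm Tp. semistandard_linked_pair r1 r2 n a Tm Tp}"

end

theory Submission
  imports Defs "HOL-Library.Product_Lexorder" "HOL-Library.Function_Algebras"
begin

text \<open>
  A filling with weakly increasing rows is determined by the multiplicities of the labels in each
  row.  The link only says that label \<open>iq\<close> occurs in row \<open>p\<close> of \<open>T\<^sup>-\<close> as often as \<open>ip\<close> occurs in
  row \<open>q\<close> of \<open>T\<^sup>+\<close>, so the vector \<open>v\<close> determines both fillings.  The row lengths being proportional to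
  \<open>r1\<close> and \<open>r2\<close>, and the columns being strictly increasing, are homogeneous linear conditions on \<open>v\<close>
  with integer coefficients; hence the vectors of semistandard linked pairs are exactly the
  lattice points of a rational polyhedral cone.  By Dickson's lemma the minimal nonzero lattice
  points are finite in number, and every lattice point of the cone is a sum of them.
\<close>

section \<open>Dickson's lemma and minimal generators of lattice points\<close>

section \<open>Hilbert bases\<close>

text \<open>A monotone subsequence exists; if it decreases, it is constant from the index of its
  minimum on, and that tail is increasing.\<close>

lemma nat_seq_incseq_subseq:
  fixes f :: "nat \<Rightarrow> nat"
  obtains g where "strict_mono g" "incseq (f \<circ> g)"
proof -
  obtain g where g: "strict_mono g" "monoseq (\<lambda>n. f (g n))"
    using seq_monosub[of f] by blast
  show thesis
  proof (cases "incseq (\<lambda>n. f (g n))")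
    case True
    then show thesis using that[of g] g by (simp add: o_def)
  next
    case False
    then have dec: "decseq (\<lambda>n. f (g n))"
      using g(2) by (simp add: monoseq_iff)
    obtain N where N: "\<And>n. f (g N) \<le> f (g n)"
      using ex_has_least_nat[of "\<lambda>_. True" 0 "\<lambda>n. f (g n)"] by auto
    have const: "f (g (N + n)) = f (g N)" for n
      using N[of "N + n"] decseqD[OF dec, of N "N + n"] by simp
    have "strict_mono (\<lambda>n. g (N + n))"
      using g(1) by (simp add: strict_mono_def)
    moreover have "incseq (f \<circ> (\<lambda>n. g (N + n)))"
      by (simp add: const incseq_def)
    ultimately show thesis using that by blast
  qed
qed

text \<open>Dickson's lemma in sequence form: coordinates are treated one at a time, and a further
  subsequence stays monotone in those already treated.\<close>

lemma Dickson_subseq: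
  fixes f :: "nat \<Rightarrow> 'i \<Rightarrow> nat"
  assumes "finite I"
  shows "\<exists>g. strict_mono g \<and> (\<forall>i\<in>I. incseq (\<lambda>n. f (g n) i))"
  using assms
proof (induction I)
  case empty
  show ?case by (rule exI[of _ id]) (simp add: strict_mono_def)
next
  case (insert i I)
  then obtain g where g: "strict_mono g" "\<forall>i\<in>I. incseq (\<lambda>n. f (g n) i)" by blast
  obtain h where h: "strict_mono h" "incseq ((\<lambda>n. f (g n) i) \<circ> h)"
    using nat_seq_incseq_subseq by blast
  have "strict_mono (g \<circ> h)"
    using g h by (simp add: strict_mono_o)
  moreover have "incseq (\<lambda>n. f ((g \<circ> h) n) k)" if "k \<in> I" for k
    using g(2) that strict_mono_mono[OF h(1)] by (simp add: incseq_def mono_def)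
  ultimately show ?case using h(2) by (intro exI[of _ "g \<circ> h"]) (auto simp: o_def)
qed

text \<open>The values of \<open>\<Phi>\<close> on \<open>S\<close> are natural numbers and separate
  points, so \<open>S\<close> embeds into a power of the naturals. Its minimal nonzero elements form
  an antichain, finite by Dickson's lemma, and every element decomposes into them by subtraction.
  Generation is phrased as containment in every additively closed set with \<open>0\<close> and
  \<open>F\<close>, which avoids sums with multiplicities.\<close>

lemma finite_Hilbert_basis:
  fixes M :: "'a::ab_group_add set" and \<Phi> :: "('a \<Rightarrow> real) set"
  assumes fin: "finite \<Phi>"
    and M_diff: "\<And>u v. u \<in> M \<Longrightarrow> v \<in> M \<Longrightarrow> u - v \<in> M"
    and diff: "\<And>\<phi> u v. \<phi> \<in> \<Phi> \<Longrightarrow> \<phi> (u - v) = \<phi> u - \<phi> v"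
    and int: "\<And>\<phi> v. \<phi> \<in> \<Phi> \<Longrightarrow> v \<in> M \<Longrightarrow> \<phi> v \<in> \<int>"
    and sep: "\<And>v. v \<in> M \<Longrightarrow> \<forall>\<phi>\<in>\<Phi>. \<phi> v = 0 \<Longrightarrow> v = 0"
  defines "S \<equiv> {v \<in> M. \<forall>\<phi>\<in>\<Phi>. 0 \<le> \<phi> v}"
  shows "\<exists>F. finite F \<and> F \<subseteq> S \<and>
    (\<forall>A. F \<subseteq> A \<longrightarrow> 0 \<in> A \<longrightarrow> (\<forall>u\<in>A. \<forall>v\<in>A. u + v \<in> A) \<longrightarrow> S \<subseteq> A)"
proof -
  define F where
    "F = {v \<in> S. v \<noteq> 0 \<and> \<not> (\<exists>u\<in>S. u \<noteq> 0 \<and> u \<noteq> v \<and> (\<forall>\<phi>\<in>\<Phi>. \<phi> u \<le> \<phi> v))}"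
  \<comment> \<open>Rounding is exact on \<open>S\<close>, where the values are nonnegative
    integers.\<close>
  define e where "e v \<phi> = nat \<lfloor>\<phi> v\<rfloor>" for v and \<phi> :: "'a \<Rightarrow> real"
  have e: "real (e v \<phi>) = \<phi> v" if "v \<in> S" "\<phi> \<in> \<Phi>" for v \<phi>
    using that int[of \<phi> v] unfolding S_def e_def by (auto simp: of_nat_nat elim!: Ints_cases)
  have "finite F"
  proof (rule ccontr)
    assume "infinite F"
    then obtain x :: "nat \<Rightarrow> 'a" where x: "inj x" "range x \<subseteq> F"
      using infinite_countable_subset by blast
    obtain g where g: "strict_mono g" "\<forall>\<phi>\<in>\<Phi>. incseq (\<lambda>n. e (x (g n)) \<phi>)"
      using Dickson_subseq[OF fin, of "\<lambda>n. e (x n)"] by blast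
    have inF: "x (g 0) \<in> F" "x (g 1) \<in> F" using x(2) by auto
    have "g 0 < g 1" using g(1) by (simp add: strict_mono_def)
    \<comment> \<open>So \<open>x (g 0)\<close> will be a nonzero element of \<open>S\<close> below
      \<open>x (g 1)\<close> and distinct from it, against minimality.\<close>
    then have "x (g 0) \<noteq> x (g 1)" using x(1) by (metis inj_eq less_irrefl)
    moreover have "\<phi> (x (g 0)) \<le> \<phi> (x (g 1))" if "\<phi> \<in> \<Phi>" for \<phi>
    proof -
      have "e (x (g 0)) \<phi> \<le> e (x (g 1)) \<phi>"
        using g(2) that by (simp add: incseq_def)
      then show ?thesis
        using e[OF _ that, of "x (g 0)"] e[OF _ that, of "x (g 1)"] inF
        by (simp add: F_def)
    qed
    ultimately show False using inF unfolding F_def by blast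
  qed
  moreover have "F \<subseteq> S" by (auto simp: F_def)
  moreover have "S \<subseteq> A"
    if A: "F \<subseteq> A" "0 \<in> A" "\<forall>u\<in>A. \<forall>v\<in>A. u + v \<in> A" for A
  proof
    fix v assume "v \<in> S"
    then show "v \<in> A"
    proof (induction "\<Sum>\<phi>\<in>\<Phi>. e v \<phi>" arbitrary: v rule: less_induct)
      case less
      show ?case
      proof (cases "v \<in> F \<or> v = 0")
        case True
        then show ?thesis using A by auto
      next
        case False
        then obtain u where u: "u \<in> S" "u \<noteq> 0" "u \<noteq> v" "\<forall>\<phi>\<in>\<Phi>. \<phi> u \<le> \<phi> v"
          using less.prems unfolding F_def by blast
        have w: "v - u \<in> S"
          using u less.prems M_diff[of v u] by (auto simp: S_def diff)
        have split: "e v \<phi> = e u \<phi> + e (v - u) \<phi>" if "\<phi> \<in> \<Phi>" for \<phi>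
        proof -
          have "real (e v \<phi>) = real (e u \<phi> + e (v - u) \<phi>)"
            using e[OF less.prems that] e[OF u(1) that] e[OF w that] diff[OF that, of v u] by simp
          then show ?thesis by linarith
        qed
        have sum: "(\<Sum>\<phi>\<in>\<Phi>. e v \<phi>) = (\<Sum>\<phi>\<in>\<Phi>. e u \<phi>) + (\<Sum>\<phi>\<in>\<Phi>. e (v - u) \<phi>)"
          by (simp add: split sum.distrib)
        \<comment> \<open>Both \<open>u\<close> and \<open>v - u\<close> are nonzero, so each has
          positive total value and therefore a smaller total than \<open>v\<close>: the induction
          descends.\<close>
        have pos: "0 < (\<Sum>\<phi>\<in>\<Phi>. e y \<phi>)" if "y \<in> S" "y \<noteq> 0" for y
        proof (rule ccontr)
          assume "\<not> ?thesis"
          then have "\<forall>\<phi>\<in>\<Phi>. e y \<phi> = 0" using fin by simp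
          then have "\<forall>\<phi>\<in>\<Phi>. \<phi> y = 0" using e[OF that(1)] by (metis of_nat_0)
          then show False using sep[of y] that by (simp add: S_def)
        qed
        have "u \<in> A" "v - u \<in> A"
          using less.hyps[of u] less.hyps[of "v - u"] sum pos[of u] pos[of "v - u"] u w by auto
        then have "u + (v - u) \<in> A" using A(3) by blast
        then show ?thesis by simp
      qed
    qed
  qed
  ultimately show ?thesis by blast
qed


section \<open>Cones\<close>

text \<open>The third assumption merges scaling and addition, which is what adding one generator to
  a finite combination requires.\<close>

lemma Cone_subsetI:
  assumes "S \<subseteq> A" "0 \<in> A"
    and "\<And>b u w. 0 \<le> b \<Longrightarrow> u \<in> A \<Longrightarrow> w \<in> A \<Longrightarrow> (\<lambda>i j k. b * u i j k + w i j k) \<in> A"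
  shows "Cone S \<subseteq> A"
proof
  fix v assume "v \<in> Cone S"
  then obtain F c where v: "v = (\<lambda>i j k. \<Sum>s\<in>F. c s * s i j k)"
    and F: "finite F" "F \<subseteq> S" "\<forall>s\<in>F. 0 \<le> c s"
    unfolding Cone_def by blast
  from F have "(\<lambda>i j k. \<Sum>s\<in>F. c s * s i j k) \<in> A"
  proof (induction F)
    case empty
    then show ?case using assms(2) by (simp add: zero_fun_def)
  next
    case (insert s F)
    then show ?case using assms(3)[of "c s" s] assms(1) by auto
  qed
  then show "v \<in> A" using v by simp
qed

lemma Cone_superset: "S \<subseteq> Cone S"
proof
  fix s assume "s \<in> S"
  then show "s \<in> Cone S"
    unfolding Cone_def by (intro CollectI exI[of _ "{s}"] exI[of _ "\<lambda>_. 1"]) auto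
qed

lemma zero_in_Cone: "0 \<in> Cone S"
  unfolding Cone_def by (intro CollectI exI[of _ "{}"]) (auto simp: zero_fun_def)

text \<open>Coefficients extended by 0 let every combination run over all of \<open>F\<close>, so
  that two combinations can be added coefficientwise.\<close>

lemma Cone_finite:
  assumes "finite F"
  shows "Cone F = {(\<lambda>i j k. \<Sum>s\<in>F. c s * s i j k) | c. \<forall>s\<in>F. 0 \<le> c s}"
proof (intro equalityI subsetI)
  fix v assume "v \<in> Cone F"
  then obtain G c where v: "v = (\<lambda>i j k. \<Sum>s\<in>G. c s * s i j k)"
    and G: "finite G" "G \<subseteq> F" "\<forall>s\<in>G. 0 \<le> c s"
    unfolding Cone_def by blast
  define d where "d s = (if s \<in> G then c s else 0)" for s
  have "(\<Sum>s\<in>G. c s * s i j k) = (\<Sum>s\<in>F. d s * s i j k)" for i j k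
    by (rule sum.mono_neutral_cong_left) (use assms G in \<open>auto simp: d_def\<close>)
  then show "v \<in> {(\<lambda>i j k. \<Sum>s\<in>F. c s * s i j k) | c. \<forall>s\<in>F. 0 \<le> c s}"
    using v G by (intro CollectI exI[of _ d]) (auto simp: d_def)
qed (use assms in \<open>auto simp: Cone_def\<close>)

lemma Cone_finite_lincomb:
  assumes "finite F" "0 \<le> b" "u \<in> Cone F" "w \<in> Cone F"
  shows "(\<lambda>i j k. b * u i j k + w i j k) \<in> Cone F"
proof -
  obtain c d where "u = (\<lambda>i j k. \<Sum>s\<in>F. c s * s i j k)" "\<forall>s\<in>F. 0 \<le> c s"
    "w = (\<lambda>i j k. \<Sum>s\<in>F. d s * s i j k)" "\<forall>s\<in>F. 0 \<le> d s"
    using assms unfolding Cone_finite[OF assms(1)] by blast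
  then show ?thesis
    unfolding Cone_finite[OF assms(1)] using assms(2)
    by (intro CollectI exI[of _ "\<lambda>s. b * c s + d s"])
      (auto simp: sum_distrib_left sum.distrib algebra_simps)
qed


section \<open>Contents of semistandard fillings\<close>

text \<open>Transfers the label order to the lexicographic \<open>linorder\<close> instance, so that
  \<open>Min\<close> and \<open>Max\<close> apply to labels.\<close>

lemma label_less_iff: "label_less x y \<longleftrightarrow> x < y"
  by (cases x; cases y) (auto simp: label_less_def less_prod_def)

lemma label_le_iff: "label_le x y \<longleftrightarrow> x \<le> y"
  by (auto simp: label_le_def label_less_iff)

lemma sum_card_fibres:
  assumes "finite C" "finite A"
  shows "(\<Sum>l\<in>A. card {c \<in> C. t c = l}) = card {c \<in> C. t c \<in> A}"
proof -
  have "card (\<Union>l\<in>A. {c \<in> C. t c = l}) = (\<Sum>l\<in>A. card {c \<in> C. t c = l})"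
    by (rule card_UN_disjoint) (use assms in auto)
  moreover have "(\<Union>l\<in>A. {c \<in> C. t c = l}) = {c \<in> C. t c \<in> A}" by auto
  ultimately show ?thesis by simp
qed

text \<open>
  The number \<open>u p l\<close> is the multiplicity of the label \<open>l\<close> in row \<open>p\<close>.  In weakly increasing rows
  \<open>p < p'\<close> the columns are strictly increasing iff, for each \<open>l\<close>, the entries \<open>\<le> l\<close> of
  row \<open>p'\<close> lie below entries \<open>< l\<close> of row \<open>p\<close>.
\<close>

definition semistandard_content ::
    "label set \<Rightarrow> nat \<Rightarrow> nat \<Rightarrow> (nat \<Rightarrow> label \<Rightarrow> nat) \<Rightarrow> bool" where
  "semistandard_content L rows cols u \<longleftrightarrow>
     (\<forall>p\<in>{1..rows}. sum (u p) L = cols) \<and>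
     (\<forall>p\<in>{1..rows}. \<forall>p'\<in>{1..rows}. p < p' \<longrightarrow>
        (\<forall>l\<in>L. sum (u p') {x \<in> L. x \<le> l} \<le> sum (u p) {x \<in> L. x < l}))"

text \<open>In a strict column an entry \<open>\<le> l\<close> in the lower row \<open>p'\<close>
  has an entry \<open>< l\<close> above it in row \<open>p\<close>; counting such columns gives the
  inequality.\<close>

lemma semistandard_content_filling:
  assumes L: "finite L" and lab: "labelled_by L rows cols T" and ss: "semistandard rows cols T"
  shows "semistandard_content L rows cols (\<lambda>p l. card {c \<in> {1..cols}. T p c = l})"
  unfolding semistandard_content_def
proof (intro conjI ballI impI)
  have in_L: "T p c \<in> L" if "p \<in> {1..rows}" "c \<in> {1..cols}" for p c
    using lab that by (auto simp: labelled_by_def boxes_def)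
  fix p assume p: "p \<in> {1..rows}"
  then have "{c \<in> {1..cols}. T p c \<in> L} = {1..cols}" using in_L by auto
  then show "(\<Sum>l\<in>L. card {c \<in> {1..cols}. T p c = l}) = cols"
    using sum_card_fibres[OF _ L, of "{1..cols}" "T p"] by simp
  fix p' l assume p': "p' \<in> {1..rows}" "p < p'" and "l \<in> L"
  have "T p c < T p' c" if "c \<in> {1..cols}" for c
    using ss p p' that by (auto simp: semistandard_def label_less_iff boxes_def)
  then have "card {c \<in> {1..cols}. T p' c \<in> {x \<in> L. x \<le> l}}
      \<le> card {c \<in> {1..cols}. T p c \<in> {x \<in> L. x < l}}"
    using in_L p by (intro card_mono) (auto intro: less_le_trans)
  then show "(\<Sum>x | x \<in> L \<and> x \<le> l. card {c \<in> {1..cols}. T p' c = x})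
      \<le> (\<Sum>x | x \<in> L \<and> x < l. card {c \<in> {1..cols}. T p c = x})"
    using L by (subst (1 2) sum_card_fibres) auto
qed

section \<open>Reconstructing a filling from its row multiplicities\<close>

text \<open>The entry in column \<open>c\<close> of the weakly increasing row with multiplicities \<open>u\<close>.\<close>

definition row_entry :: "'a::linorder set \<Rightarrow> ('a \<Rightarrow> nat) \<Rightarrow> nat \<Rightarrow> 'a" where
  "row_entry L u c = Min {l \<in> L. c \<le> sum u {x \<in> L. x \<le> l}}"

context
  fixes L :: "'a::linorder set" and u :: "'a \<Rightarrow> nat" and c :: nat
  assumes L: "finite L" and c: "c \<in> {1..sum u L}"
begin

text \<open>The set under \<open>Min\<close> is nonempty: the partial sum up to \<open>Max L\<close>
  is the whole row length, which is at least \<open>c\<close>.\<close>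

lemma row_entry_in: "row_entry L u c \<in> {l \<in> L. c \<le> sum u {x \<in> L. x \<le> l}}"
proof -
  have "L \<noteq> {}" using c by auto
  moreover have "{x \<in> L. x \<le> Max L} = L" using L by auto
  ultimately have "Max L \<in> {l \<in> L. c \<le> sum u {x \<in> L. x \<le> l}}" using L c by auto
  then have "{l \<in> L. c \<le> sum u {x \<in> L. x \<le> l}} \<noteq> {}" by blast
  then show ?thesis unfolding row_entry_def using L by (intro Min_in) auto
qed

text \<open>Partial sums grow with \<open>l\<close>, so the set whose minimum is taken is upward
  closed in \<open>L\<close>.\<close>

lemma row_entry_le_iff:
  assumes "l \<in> L"
  shows "row_entry L u c \<le> l \<longleftrightarrow> c \<le> sum u {x \<in> L. x \<le> l}"
proof
  assume "row_entry L u c \<le> l"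
  then have "sum u {x \<in> L. x \<le> row_entry L u c} \<le> sum u {x \<in> L. x \<le> l}"
    using L by (intro sum_mono2) auto
  then show "c \<le> sum u {x \<in> L. x \<le> l}" using row_entry_in by auto
next
  assume "c \<le> sum u {x \<in> L. x \<le> l}"
  then show "row_entry L u c \<le> l"
    unfolding row_entry_def using L assms by (intro Min_le) auto
qed

text \<open>For the largest \<open>y\<close> in \<open>L\<close> below \<open>l\<close> this is
  \<open>row_entry_le_iff\<close>. If there is no such \<open>y\<close>, both sides fail, the right
  one because columns start at 1.\<close>

lemma row_entry_less_iff:
  "row_entry L u c < l \<longleftrightarrow> c \<le> sum u {x \<in> L. x < l}"
proof (cases "{x \<in> L. x < l} = {}")
  case True
  moreover have "\<not> row_entry L u c < l" using True row_entry_in by auto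
  moreover have "\<not> c \<le> sum u {x \<in> L. x < l}" unfolding True using c by simp
  ultimately show ?thesis by blast
next
  case False
  define y where "y = Max {x \<in> L. x < l}"
  have y: "y \<in> L" "y < l"
    using Max_in[OF _ False] L unfolding y_def by auto
  have y_max: "x \<le> y" if "x \<in> L" "x < l" for x
    unfolding y_def using L that by (intro Max_ge) auto
  have "{x \<in> L. x \<le> y} = {x \<in> L. x < l}" using y y_max by auto
  moreover have "row_entry L u c < l \<longleftrightarrow> row_entry L u c \<le> y"
    using y y_max row_entry_in by auto
  ultimately show ?thesis using row_entry_le_iff[OF y(1)] by simp
qed

end

text \<open>The label \<open>l\<close> fills the columns after the partial sum of the smaller labels
  and up to the one including \<open>l\<close>, an interval of length \<open>u l\<close>.\<close>

lemma card_row_entry: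
  assumes "finite L" "l \<in> L"
  shows "card {c \<in> {1..sum u L}. row_entry L u c = l} = u l"
proof -
  have le: "sum u {x \<in> L. x < l} \<le> sum u L" "sum u {x \<in> L. x \<le> l} \<le> sum u L"
    using assms by (auto intro!: sum_mono2)
  have "{x \<in> L. x \<le> l} = insert l {x \<in> L. x < l}" using assms by auto
  then have sum: "sum u {x \<in> L. x \<le> l} = u l + sum u {x \<in> L. x < l}"
    using assms by simp
  have "{c \<in> {1..sum u L}. row_entry L u c = l}
      = {c \<in> {1..sum u L}. row_entry L u c \<le> l \<and> \<not> row_entry L u c < l}" by auto
  also have "\<dots> = {c \<in> {1..sum u L}. c \<le> sum u {x \<in> L. x \<le> l} \<and> \<not> c \<le> sum u {x \<in> L. x < l}}"
    using row_entry_le_iff[OF assms(1) _ assms(2)] row_entry_less_iff[OF assms(1)] by blast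
  also have "\<dots> = {sum u {x \<in> L. x < l}<..sum u {x \<in> L. x \<le> l}}"
    using le by auto
  finally show ?thesis using sum by simp
qed

text \<open>Each row is the sorted word with the prescribed multiplicities; the content inequalities
  make the columns strict.\<close>

lemma semistandard_filling_exists:
  assumes L: "finite L" and u: "semistandard_content L rows cols u"
  obtains T where "labelled_by L rows cols T" "semistandard rows cols T"
    "\<And>p l. p \<in> {1..rows} \<Longrightarrow> l \<in> L \<Longrightarrow> card {c \<in> {1..cols}. T p c = l} = u p l"
proof
  let ?T = "\<lambda>p. row_entry L (u p)"
  have cols: "sum (u p) L = cols" if "p \<in> {1..rows}" for p
    using u that by (simp add: semistandard_content_def)
  have in_T: "?T p c \<in> L" "c \<le> sum (u p) {x \<in> L. x \<le> ?T p c}"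
    if "p \<in> {1..rows}" "c \<in> {1..cols}" for p c
    using row_entry_in[OF L, of c "u p"] cols that by auto
  show "labelled_by L rows cols ?T"
    using in_T(1) by (auto simp: labelled_by_def boxes_def)
  show "card {c \<in> {1..cols}. ?T p c = l} = u p l" if "p \<in> {1..rows}" "l \<in> L" for p l
    using card_row_entry[OF L that(2), of "u p"] cols[OF that(1)] by simp
  have row: "?T p c \<le> ?T p c'"
    if "p \<in> {1..rows}" "c \<in> {1..cols}" "c' \<in> {1..cols}" "c < c'" for p c c'
    using row_entry_le_iff[OF L, of c "u p" "?T p c'"] cols in_T[of p c'] that by auto
  have col: "?T p c < ?T p' c"
    if "p \<in> {1..rows}" "p' \<in> {1..rows}" "c \<in> {1..cols}" "p < p'" for p p' c
  proof -
    \<comment> \<open>At least \<open>c\<close> entries of row \<open>p'\<close> are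
      \<open>\<le> ?T p' c\<close>, so at least \<open>c\<close> entries of row \<open>p\<close> are
      smaller than it; in the sorted row \<open>p\<close> the entry in column \<open>c\<close> is
      among them.\<close>
    have "c \<le> sum (u p') {x \<in> L. x \<le> ?T p' c}" using in_T that by blast
    also have "\<dots> \<le> sum (u p) {x \<in> L. x < ?T p' c}"
      using u in_T(1)[of p' c] that by (simp add: semistandard_content_def)
    finally show ?thesis using row_entry_less_iff[OF L, of c "u p"] cols that by simp
  qed
  show "semistandard rows cols ?T"
    using row col by (auto simp: semistandard_def label_less_iff label_le_iff boxes_def)
qed


section \<open>Links\<close>

text \<open>Finite fibres of equal cardinality are in bijection; the chosen bijections glue because
  \<open>f x\<close> stays over \<open>\<kappa> x\<close>, so distinct fibres have disjoint
  images.\<close>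

lemma bij_betw_fibrewise:
  assumes fin: "finite X" "finite Y"
    and card: "\<And>z. card {x \<in> X. \<kappa> x = z} = card {y \<in> Y. \<mu> y = z}"
  obtains f where "bij_betw f X Y" "\<And>x. x \<in> X \<Longrightarrow> \<mu> (f x) = \<kappa> x"
proof -
  have "\<exists>h. bij_betw h {x \<in> X. \<kappa> x = z} {y \<in> Y. \<mu> y = z}" for z
    using card fin by (intro finite_same_card_bij) auto
  then obtain h where h: "\<And>z. bij_betw (h z) {x \<in> X. \<kappa> x = z} {y \<in> Y. \<mu> y = z}" by metis
  define f where "f x = h (\<kappa> x) x" for x
  have f: "f x \<in> Y" "\<mu> (f x) = \<kappa> x" if "x \<in> X" for x
    using bij_betwE[OF h[of "\<kappa> x"]] that by (auto simp: f_def)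
  have "inj_on f X"
  proof (rule inj_onI)
    fix x x' assume xx: "x \<in> X" "x' \<in> X" "f x = f x'"
    then have "\<kappa> x = \<kappa> x'" using f(2) by metis
    then show "x = x'"
      using xx bij_betw_imp_inj_on[OF h[of "\<kappa> x"]] by (auto simp: f_def inj_on_def)
  qed
  moreover have "y \<in> f ` X" if "y \<in> Y" for y
  proof -
    have "y \<in> h (\<mu> y) ` {x \<in> X. \<kappa> x = \<mu> y}"
      using bij_betw_imp_surj_on[OF h[of "\<mu> y"]] that by auto
    then show ?thesis unfolding f_def by force
  qed
  ultimately have "bij_betw f X Y" using f(1) by (auto simp: bij_betw_def)
  then show thesis using that f(2) by blast
qed

lemma bij_betw_card_fibres:
  assumes f: "bij_betw f X Y" and \<mu>f: "\<And>x. x \<in> X \<Longrightarrow> \<mu> (f x) = \<kappa> x"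
  shows "card {x \<in> X. \<kappa> x = z} = card {y \<in> Y. \<mu> y = z}"
proof -
  have "f ` {x \<in> X. \<kappa> x = z} = {y \<in> Y. \<mu> y = z}"
    using \<mu>f by (auto simp flip: bij_betw_imp_surj_on[OF f])
  moreover have "inj_on f {x \<in> X. \<kappa> x = z}"
    using bij_betw_imp_inj_on[OF f] by (rule inj_on_subset) auto
  ultimately show ?thesis using card_image by metis
qed

text \<open>A link is a bijection of boxes that preserves a key, so it exists exactly if the fibres
  of the keys have equal cardinalities.\<close>

lemma link_iff:
  assumes Tm: "labelled_by ({1..n} \<times> {1..r2}) r1 w2 Tm"
    and Tp: "labelled_by ({1..n} \<times> {1..r1}) r2 w1 Tp"
  shows "(\<exists>f. bij_betw f (boxes r1 w2) (boxes r2 w1) \<and>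
          (\<forall>p c i q. (p, c) \<in> boxes r1 w2 \<and> Tm p c = (i, q) \<longrightarrow>
             (\<exists>d. f (p, c) = (q, d) \<and> Tp q d = (i, p)))) \<longleftrightarrow>
    (\<forall>i\<in>{1..n}. \<forall>q\<in>{1..r2}. \<forall>p\<in>{1..r1}.
       card {c \<in> {1..w2}. Tm p c = (i, q)} = card {d \<in> {1..w1}. Tp q d = (i, p)})"
    (is "?link \<longleftrightarrow> ?cards")
proof -
  \<comment> \<open>A key records a label and its row, on the \<open>Tp\<close> side with the row
    and the second index swapped. The link condition becomes
    \<open>\<mu> (f x) = \<kappa> x\<close>.\<close>
  define \<kappa> where "\<kappa> = (\<lambda>(p, c). (Tm p c, p))"
  define \<mu> where "\<mu> = (\<lambda>(q, d). ((fst (Tp q d), q), snd (Tp q d)))"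
  have \<kappa>: "{x \<in> boxes r1 w2. \<kappa> x = ((i, q), p)}
      = (if p \<in> {1..r1} then Pair p ` {c \<in> {1..w2}. Tm p c = (i, q)} else {})" for i q p
    by (auto simp: \<kappa>_def boxes_def)
  have \<mu>: "{y \<in> boxes r2 w1. \<mu> y = ((i, q), p)}
      = (if q \<in> {1..r2} then Pair q ` {d \<in> {1..w1}. Tp q d = (i, p)} else {})" for i q p
    by (auto simp: \<mu>_def boxes_def)
  have card: "card (Pair a ` A) = card A" for a :: nat and A :: "nat set"
    by (simp add: card_image inj_on_def)
  have fin: "finite (boxes r1 w2)" "finite (boxes r2 w1)" by (auto simp: boxes_def)
  show ?thesis
  proof
    assume ?link
    then obtain f where f: "bij_betw f (boxes r1 w2) (boxes r2 w1)"
      and link: "\<And>p c i q. (p, c) \<in> boxes r1 w2 \<Longrightarrow> Tm p c = (i, q) \<Longrightarrow>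
        \<exists>d. f (p, c) = (q, d) \<and> Tp q d = (i, p)" by blast
    have \<mu>f: "\<mu> (f x) = \<kappa> x" if x: "x \<in> boxes r1 w2" for x
    proof -
      obtain p c i q where [simp]: "x = (p, c)" "Tm p c = (i, q)" by (metis surj_pair)
      then show ?thesis using link[of p c i q] x by (auto simp: \<kappa>_def \<mu>_def)
    qed
    have "card {x \<in> boxes r1 w2. \<kappa> x = z} = card {y \<in> boxes r2 w1. \<mu> y = z}" for z
      using \<mu>f by (intro bij_betw_card_fibres[where \<mu> = \<mu> and \<kappa> = \<kappa>, OF f])
    note fibres = this[of "((i, q), p)" for i q p]
    show ?cards
    proof (intro ballI)
      fix i q p assume "q \<in> {1..r2}" "p \<in> {1..r1}"
      then show "card {c \<in> {1..w2}. Tm p c = (i, q)} = card {d \<in> {1..w1}. Tp q d = (i, p)}"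
        using fibres[of i q p] by (simp only: \<kappa> \<mu> card if_True)
    qed
  next
    assume cards: ?cards
    have "card {x \<in> boxes r1 w2. \<kappa> x = z} = card {y \<in> boxes r2 w1. \<mu> y = z}" for z
    proof -
      obtain i q p where z: "z = ((i, q), p)" by (metis surj_pair)
      show ?thesis
      proof (cases "i \<in> {1..n} \<and> q \<in> {1..r2} \<and> p \<in> {1..r1}")
        case True
        then show ?thesis using cards by (simp add: z \<kappa> \<mu> card)
      next
        \<comment> \<open>Outside the index range both fibres are empty, as rows and labels of the
          fillings lie in the range.\<close>
        case False
        then have Tm_neq: "Tm p c \<noteq> (i, q)" if "(p, c) \<in> boxes r1 w2" for c
          using bspec[OF Tm[unfolded labelled_by_def] that] that by (auto simp: boxes_def)
        have Tp_neq: "Tp q d \<noteq> (i, p)" if "(q, d) \<in> boxes r2 w1" for d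
          using False bspec[OF Tp[unfolded labelled_by_def] that] that by (auto simp: boxes_def)
        have "{x \<in> boxes r1 w2. \<kappa> x = z} = {}"
          by (auto simp: z \<kappa>_def Tm_neq)
        moreover have "{y \<in> boxes r2 w1. \<mu> y = z} = {}"
          using Tp_neq by (auto simp: z \<mu>_def prod_eq_iff)
        ultimately show ?thesis by (simp only: card.empty)
      qed
    qed
    then obtain f where f: "bij_betw f (boxes r1 w2) (boxes r2 w1)"
      and \<mu>f: "\<And>x. x \<in> boxes r1 w2 \<Longrightarrow> \<mu> (f x) = \<kappa> x"
      using bij_betw_fibrewise[OF fin] by blast
    have "\<exists>d. f (p, c) = (q, d) \<and> Tp q d = (i, p)"
      if "(p, c) \<in> boxes r1 w2" "Tm p c = (i, q)" for p c i q
    proof -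
      obtain q' d where fq: "f (p, c) = (q', d)" by (metis surj_pair)
      show ?thesis using \<mu>f[OF that(1)] that(2) by (auto simp: fq \<kappa>_def \<mu>_def prod_eq_iff)
    qed
    with f show ?link by blast
  qed
qed


section \<open>The inequalities defining the cone\<close>

text \<open>The vector read as multiplicities in \<open>Tp\<close>; polymorphic, to serve both
  natural multiplicities and real functionals.\<close>

definition plus_rows :: "(nat \<Rightarrow> nat \<Rightarrow> nat \<Rightarrow> 'a) \<Rightarrow> nat \<Rightarrow> label \<Rightarrow> 'a" where
  "plus_rows v j l = v (fst l) j (snd l)"

text \<open>The link transposes: label \<open>(i, q)\<close> in row \<open>p\<close> of
  \<open>Tm\<close> is counted by the coordinate \<open>v i q p\<close>.\<close>

definition minus_rows :: "(nat \<Rightarrow> nat \<Rightarrow> nat \<Rightarrow> 'a) \<Rightarrow> nat \<Rightarrow> label \<Rightarrow> 'a" where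
  "minus_rows v k l = v (fst l) (snd l) k"

section \<open>Row lengths and the passage between fillings and vectors\<close>

lemma semistandard_content_cong:
  assumes "\<And>p l. p \<in> {1..rows} \<Longrightarrow> l \<in> L \<Longrightarrow> u p l = u' p l"
  shows "semistandard_content L rows cols u \<longleftrightarrow> semistandard_content L rows cols u'"
proof -
  have "sum (u p) A = sum (u' p) A" if "p \<in> {1..rows}" "A \<subseteq> L" for p A
    using assms that by (intro sum.cong) auto
  then show ?thesis unfolding semistandard_content_def by (simp cong: conj_cong)
qed

text \<open>Since the gcd divides \<open>r\<close>, the product under the floor is already a natural
  number.\<close>

lemma width_multiple:
  assumes "0 < r1" "r \<in> {r1, r2}"
  shows "width (of_nat m / of_nat (gcd r1 r2)) r = m * (r div gcd r1 r2)"
proof -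
  define g where "g = gcd r1 r2"
  have g: "g dvd r" "0 < g" using assms by (auto simp: g_def)
  then obtain k where k: "r = g * k" by blast
  have "(of_nat m / of_nat g :: rat) * of_nat r = of_nat (m * k)"
    using g(2) by (simp add: k)
  then show ?thesis
    using g(2) unfolding width_def g_def[symmetric] by (simp only: floor_of_nat nat_int) (simp add: k)
qed

text \<open>Division by the gcd leaves coprime factors, so \<open>r1 div gcd r1 r2\<close> divides
  \<open>w1\<close>. The quotient \<open>m\<close> will be the numerator of
  \<open>a\<close>.\<close>

lemma proportional_imp_common_multiple:
  fixes r1 r2 w1 w2 :: nat
  assumes "0 < r1" "w1 * r2 = w2 * r1"
  obtains m where "w1 = m * (r1 div gcd r1 r2)" "w2 = m * (r2 div gcd r1 r2)"
proof -
  let ?g = "gcd r1 r2"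
  obtain s1 s2 where s: "r1 = ?g * s1" "r2 = ?g * s2" by (meson dvd_def gcd_dvd1 gcd_dvd2)
  have g: "0 < ?g" using assms by simp
  have div: "r1 div ?g = s1" "r2 div ?g = s2"
    using s g by (metis nonzero_mult_div_cancel_left less_numeral_extra(3))+
  have cop: "coprime s1 s2" using div_gcd_coprime[of r1 r2] assms div by simp
  have "?g * (w1 * s2) = ?g * (w2 * s1)" using assms(2) s by (metis mult.left_commute)
  then have eq: "w1 * s2 = w2 * s1" using nat_mult_eq_cancel1[OF g] by blast
  then have "s1 dvd w1 * s2" by simp
  then have "s1 dvd w1" using cop by (simp add: coprime_dvd_mult_left_iff)
  then obtain m where m: "w1 = m * s1" by (metis dvd_def mult.commute)
  have "0 < s1" using s(1) assms(1) by (metis gr0I mult_0_right less_numeral_extra(3))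
  then have "w2 = m * s2" using eq m by (simp add: algebra_simps)
  with m show thesis by (intro that[of m]) (simp_all only: div)
qed

lemma filling_fibre_empty:
  assumes "labelled_by ({1..n} \<times> {1..r1}) r2 w T" "(i, j, k) \<notin> index_set r1 r2 n"
  shows "{c. (j, c) \<in> boxes r2 w \<and> T j c = (i, k)} = {}"
proof -
  have "(i, j, k) \<in> index_set r1 r2 n" if "(j, c) \<in> boxes r2 w" "T j c = (i, k)" for c
    using bspec[OF assms(1)[unfolded labelled_by_def] that(1)] that
    by (auto simp: index_set_def boxes_def)
  with assms(2) show ?thesis by blast
qed

text \<open>Counting labels gives \<open>u\<close> one way. Conversely, both fillings are built from
  the same \<open>u\<close>, so their label counts match and \<open>link_iff\<close> supplies the
  link.\<close>

lemma semistandard_vecs_iff: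
  assumes "0 < r1"
  shows "v \<in> semistandard_vecs r1 r2 n \<longleftrightarrow> v \<in> real_space r1 r2 n \<and>
    (\<exists>u w1 w2. v = (\<lambda>i j k. real (u i j k)) \<and> w1 * r2 = w2 * r1 \<and>
      semistandard_content ({1..n} \<times> {1..r1}) r2 w1 (plus_rows u) \<and>
      semistandard_content ({1..n} \<times> {1..r2}) r1 w2 (minus_rows u))"
    (is "_ \<longleftrightarrow> _ \<and> (\<exists>u w1 w2. ?P u w1 w2)")
proof
  assume "v \<in> semistandard_vecs r1 r2 n"
  then obtain a Tm Tp where v: "v = pair_vec r1 r2 a Tp"
    and T: "semistandard_linked_pair r1 r2 n a Tm Tp"
    unfolding semistandard_vecs_def by blast
  define w1 w2 where "w1 = width a r1" and "w2 = width a r2"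
  obtain m where a: "a = of_nat m / of_nat (gcd r1 r2)"
    using T by (auto simp: semistandard_linked_pair_def linked_pair_def)
  have "(r1 div gcd r1 r2) * r2 = (r2 div gcd r1 r2) * r1"
    by (metis dvd_div_mult gcd_dvd1 gcd_dvd2 mult.commute)
  then have w: "w1 * r2 = w2 * r1"
    using assms unfolding w1_def w2_def a by (simp add: width_multiple)
  have Tm: "labelled_by ({1..n} \<times> {1..r2}) r1 w2 Tm" "semistandard r1 w2 Tm"
    and Tp: "labelled_by ({1..n} \<times> {1..r1}) r2 w1 Tp" "semistandard r2 w1 Tp"
    using T by (auto simp: semistandard_linked_pair_def linked_pair_def w1_def w2_def)
  have link: "card {c \<in> {1..w2}. Tm p c = (i, q)} = card {d \<in> {1..w1}. Tp q d = (i, p)}"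
    if "i \<in> {1..n}" "q \<in> {1..r2}" "p \<in> {1..r1}" for i p q
    using T link_iff[OF Tm(1) Tp(1)] that
    unfolding semistandard_linked_pair_def linked_pair_def w1_def w2_def by blast
  \<comment> \<open>Counting over \<open>boxes\<close> makes \<open>u\<close> vanish for rows
    outside the rectangle, as \<open>real_space\<close> demands.\<close>
  define u where "u i j k = card {c. (j, c) \<in> boxes r2 w1 \<and> Tp j c = (i, k)}" for i j k
  have u: "u i j k = card {c \<in> {1..w1}. Tp j c = (i, k)}" if "j \<in> {1..r2}" for i j k
    using that by (simp add: u_def boxes_def)
  have "u i j k = 0" if "(i, j, k) \<notin> index_set r1 r2 n" for i j k
  proof -
    have "{c. (j, c) \<in> boxes r2 w1 \<and> Tp j c = (i, k)} = {}"
      using filling_fibre_empty[OF Tp(1) that] .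
    then show ?thesis by (simp only: u_def card.empty)
  qed
  moreover have v_u: "v = (\<lambda>i j k. real (u i j k))"
    by (simp add: v pair_vec_def u_def w1_def)
  ultimately have "v \<in> real_space r1 r2 n" by (simp add: real_space_def)
  moreover have "semistandard_content ({1..n} \<times> {1..r1}) r2 w1 (plus_rows u)"
    using semistandard_content_filling[OF _ Tp]
    by (rule iffD1[OF semistandard_content_cong, rotated]) (auto simp: plus_rows_def u)
  moreover have "semistandard_content ({1..n} \<times> {1..r2}) r1 w2 (minus_rows u)"
    using semistandard_content_filling[OF _ Tm]
    by (rule iffD1[OF semistandard_content_cong, rotated]) (use link in \<open>auto simp: minus_rows_def u\<close>)
  ultimately show "v \<in> real_space r1 r2 n \<and> (\<exists>u w1 w2. ?P u w1 w2)" using v_u w by blast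
next
  assume "v \<in> real_space r1 r2 n \<and> (\<exists>u w1 w2. ?P u w1 w2)"
  then obtain u w1 w2 where v: "v \<in> real_space r1 r2 n" "v = (\<lambda>i j k. real (u i j k))"
    and w: "w1 * r2 = w2 * r1"
    and plus: "semistandard_content ({1..n} \<times> {1..r1}) r2 w1 (plus_rows u)"
    and minus: "semistandard_content ({1..n} \<times> {1..r2}) r1 w2 (minus_rows u)"
    by blast
  obtain m where m: "w1 = m * (r1 div gcd r1 r2)" "w2 = m * (r2 div gcd r1 r2)"
    using proportional_imp_common_multiple[OF assms w] .
  define a :: rat where "a = of_nat m / of_nat (gcd r1 r2)"
  have width: "width a r1 = w1" "width a r2 = w2"
    using assms by (auto simp: a_def width_multiple m)
  obtain Tp where Tp: "labelled_by ({1..n} \<times> {1..r1}) r2 w1 Tp" "semistandard r2 w1 Tp"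
    and Tp_u: "\<And>p l. p \<in> {1..r2} \<Longrightarrow> l \<in> {1..n} \<times> {1..r1} \<Longrightarrow>
      card {c \<in> {1..w1}. Tp p c = l} = plus_rows u p l"
    using semistandard_filling_exists[OF _ plus] by blast
  obtain Tm where Tm: "labelled_by ({1..n} \<times> {1..r2}) r1 w2 Tm" "semistandard r1 w2 Tm"
    and Tm_u: "\<And>p l. p \<in> {1..r1} \<Longrightarrow> l \<in> {1..n} \<times> {1..r2} \<Longrightarrow>
      card {c \<in> {1..w2}. Tm p c = l} = minus_rows u p l"
    using semistandard_filling_exists[OF _ minus] by blast
  have "\<forall>i\<in>{1..n}. \<forall>q\<in>{1..r2}. \<forall>p\<in>{1..r1}.
       card {c \<in> {1..w2}. Tm p c = (i, q)} = card {d \<in> {1..w1}. Tp q d = (i, p)}"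
    by (intro ballI, subst Tm_u, simp, simp, subst Tp_u) (auto simp: plus_rows_def minus_rows_def)
  then have "linked_pair r1 r2 n a Tm Tp"
    using link_iff[OF Tm(1) Tp(1)] Tm(1) Tp(1)
    unfolding linked_pair_def width by (auto simp only: a_def)
  then have "semistandard_linked_pair r1 r2 n a Tm Tp"
    using Tm(2) Tp(2) unfolding semistandard_linked_pair_def width by blast
  moreover have "v i j k = pair_vec r1 r2 a Tp i j k" for i j k
  proof (cases "(i, j, k) \<in> index_set r1 r2 n")
    case True
    then have "pair_vec r1 r2 a Tp i j k = real (card {c \<in> {1..w1}. Tp j c = (i, k)})"
      by (simp add: pair_vec_def width boxes_def index_set_def)
    also have "\<dots> = v i j k"
      using True by (subst Tp_u) (auto simp: index_set_def plus_rows_def v(2))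
    finally show ?thesis by simp
  next
    case False
    then have "{c. (j, c) \<in> boxes r2 w1 \<and> Tp j c = (i, k)} = {}"
      by (rule filling_fibre_empty[OF Tp(1)])
    moreover have "v i j k = 0" using False v(1) by (simp add: real_space_def)
    ultimately show ?thesis by (simp only: pair_vec_def width card.empty of_nat_0)
  qed
  ultimately show "v \<in> semistandard_vecs r1 r2 n"
    unfolding semistandard_vecs_def by blast
qed

section \<open>Linear functionals cutting out the cone\<close>

definition column_gap :: "label set \<Rightarrow> nat \<times> nat \<times> label \<Rightarrow> (nat \<Rightarrow> label \<Rightarrow> real) \<Rightarrow> real" where
  "column_gap L = (\<lambda>(p, p', l) u. sum (u p) {x \<in> L. x < l} - sum (u p') {x \<in> L. x \<le> l})"

definition column_pairs :: "label set \<Rightarrow> nat \<Rightarrow> (nat \<times> nat \<times> label) set" where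
  "column_pairs L rows = {(p, p', l) \<in> {1..rows} \<times> {1..rows} \<times> L. p < p'}"

text \<open>
  The functionals with a sign \<open>s\<close> encode equations: the existence of a common \<open>a\<close> with all row
  sums equal to \<open>a r1\<close> in \<open>T\<^sup>+\<close> and \<open>a r2\<close> in \<open>T\<^sup>-\<close> is expressed by cross multiplication.
\<close>

definition semistandard_functionals :: "nat \<Rightarrow> nat \<Rightarrow> nat \<Rightarrow> (coord_vec \<Rightarrow> real) set" where
  "semistandard_functionals r1 r2 n =
     (\<lambda>(i, j, k) v. v i j k) ` index_set r1 r2 n \<union>
     (\<lambda>(s, j, k) v. s * (real r2 * sum (plus_rows v j) ({1..n} \<times> {1..r1})
         - real r1 * sum (minus_rows v k) ({1..n} \<times> {1..r2})))
       ` ({-1, 1} \<times> {1..r2} \<times> {1..r1}) \<union>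
     (\<lambda>t v. column_gap ({1..n} \<times> {1..r1}) t (plus_rows v))
       ` column_pairs ({1..n} \<times> {1..r1}) r2 \<union>
     (\<lambda>t v. column_gap ({1..n} \<times> {1..r2}) t (minus_rows v))
       ` column_pairs ({1..n} \<times> {1..r2}) r1"

lemma coord_in_semistandard_functionals:
  assumes "(i, j, k) \<in> index_set r1 r2 n"
  shows "(\<lambda>v. v i j k) \<in> semistandard_functionals r1 r2 n"
  unfolding semistandard_functionals_def
  by (intro UnI1 image_eqI[of _ _ "(i, j, k)"]) (use assms in auto)

text \<open>An equation is a pair of opposite inequalities. The \<open>case\<close> stands in
  function position to match what unfolding the image in \<open>semistandard_functionals\<close>
  leaves.\<close>

lemma signed_functionals_nonneg_iff:
  fixes f :: "'v \<Rightarrow> 'i \<Rightarrow> real" and g :: "'v \<Rightarrow> 'j \<Rightarrow> real"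
  shows "(\<forall>x\<in>{-1, 1} \<times> J \<times> K. 0 \<le> (case x of (s, j, k) \<Rightarrow> \<lambda>v. s * (f v j - g v k)) v) \<longleftrightarrow>
    (\<forall>j\<in>J. \<forall>k\<in>K. f v j = g v k)"
proof (intro iffI ballI)
  fix j k
  assume *: "\<forall>x\<in>{-1, 1} \<times> J \<times> K. 0 \<le> (case x of (s, j, k) \<Rightarrow> \<lambda>v. s * (f v j - g v k)) v"
    and jk: "j \<in> J" "k \<in> K"
  show "f v j = g v k"
    using bspec[OF *, of "(-1, j, k)"] bspec[OF *, of "(1, j, k)"] jk by simp
next
  fix x :: "real \<times> 'i \<times> 'j"
  assume "\<forall>j\<in>J. \<forall>k\<in>K. f v j = g v k" "x \<in> {-1, 1} \<times> J \<times> K"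
  then show "0 \<le> (case x of (s, j, k) \<Rightarrow> \<lambda>v. s * (f v j - g v k)) v"
    by (cases x) auto
qed

lemma finite_semistandard_functionals: "finite (semistandard_functionals r1 r2 n)"
proof -
  have "finite (column_pairs L rows)" if "finite L" for L rows
    unfolding column_pairs_def
    by (rule finite_subset[of _ "{1..rows} \<times> {1..rows} \<times> L"]) (use that in auto)
  then show ?thesis by (simp add: semistandard_functionals_def index_set_def)
qed

text \<open>One identity covers the combinations in \<open>Cone_subsetI\<close> and, through
  \<open>b = -1\<close>, differences.\<close>

lemma semistandard_functionals_linear:
  assumes "\<phi> \<in> semistandard_functionals r1 r2 n"
  shows "\<phi> (\<lambda>i j k. b * u i j k + w i j k) = b * \<phi> u + \<phi> w"
proof -
  have "sum (plus_rows (\<lambda>i j k. b * u i j k + w i j k) j) A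
      = b * sum (plus_rows u j) A + sum (plus_rows w j) A" for j A
    by (simp add: plus_rows_def sum.distrib sum_distrib_left)
  moreover have "sum (minus_rows (\<lambda>i j k. b * u i j k + w i j k) k) A
      = b * sum (minus_rows u k) A + sum (minus_rows w k) A" for k A
    by (simp add: minus_rows_def sum.distrib sum_distrib_left)
  ultimately show ?thesis
    using assms unfolding semistandard_functionals_def
    by (elim UnE imageE) (auto simp: column_gap_def algebra_simps split: prod.splits)
qed

lemma semistandard_functionals_Ints:
  assumes "\<phi> \<in> semistandard_functionals r1 r2 n" "v \<in> int_lattice r1 r2 n"
  shows "\<phi> v \<in> \<int>"
proof -
  have "v i j k \<in> \<int>" for i j k using assms(2) by (simp add: int_lattice_def)
  then show ?thesis
    using assms(1) unfolding semistandard_functionals_def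
    by (auto simp: column_gap_def plus_rows_def minus_rows_def intro!: Ints_diff Ints_mult Ints_sum)
qed

text \<open>\<open>column_gap\<close> is the slack in the column inequality of
  \<open>semistandard_content\<close>.\<close>

lemma column_gap_nonneg_iff:
  fixes u :: "nat \<Rightarrow> label \<Rightarrow> nat"
  shows "(\<forall>t \<in> column_pairs L rows. 0 \<le> column_gap L t (\<lambda>p l. real (u p l))) \<longleftrightarrow>
    (\<forall>p\<in>{1..rows}. \<forall>p'\<in>{1..rows}. p < p' \<longrightarrow>
      (\<forall>l\<in>L. sum (u p') {x \<in> L. x \<le> l} \<le> sum (u p) {x \<in> L. x < l}))"
  by (auto simp: column_pairs_def column_gap_def simp flip: of_nat_sum)

text \<open>Nonnegative coordinates turn a lattice point into a vector of naturals; on those the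
  other functionals express proportional row lengths and the column inequalities.\<close>

lemma semistandard_vecs_eq:
  assumes "0 < r1" "0 < r2"
  shows "semistandard_vecs r1 r2 n =
    {v \<in> int_lattice r1 r2 n. \<forall>\<phi>\<in>semistandard_functionals r1 r2 n. 0 \<le> \<phi> v}"
proof -
  let ?L1 = "{1..n} \<times> {1..r1}" and ?L2 = "{1..n} \<times> {1..r2}"
  have rows: "plus_rows (\<lambda>i j k. real (u i j k)) = (\<lambda>p l. real (plus_rows u p l))"
    "minus_rows (\<lambda>i j k. real (u i j k)) = (\<lambda>p l. real (minus_rows u p l))"
    for u :: "nat \<Rightarrow> nat \<Rightarrow> nat \<Rightarrow> nat"
    by (simp_all add: fun_eq_iff plus_rows_def minus_rows_def)
  have nonneg_iff: "(\<forall>\<phi>\<in>semistandard_functionals r1 r2 n. 0 \<le> \<phi> (\<lambda>i j k. real (u i j k))) \<longleftrightarrow>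
    (\<exists>w1 w2. w1 * r2 = w2 * r1 \<and> semistandard_content ?L1 r2 w1 (plus_rows u) \<and>
      semistandard_content ?L2 r1 w2 (minus_rows u))" (is "?nonneg \<longleftrightarrow> ?content") for u
  proof -
    have "?nonneg \<longleftrightarrow>
      (\<forall>j\<in>{1..r2}. \<forall>k\<in>{1..r1}. r2 * sum (plus_rows u j) ?L1 = r1 * sum (minus_rows u k) ?L2) \<and>
      (\<forall>t \<in> column_pairs ?L1 r2. 0 \<le> column_gap ?L1 t (\<lambda>p l. real (plus_rows u p l))) \<and>
      (\<forall>t \<in> column_pairs ?L2 r1. 0 \<le> column_gap ?L2 t (\<lambda>p l. real (minus_rows u p l)))"
      (is "_ \<longleftrightarrow> ?sums \<and> ?gaps")
    proof -
      have coords: "\<forall>x\<in>index_set r1 r2 n.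
          0 \<le> (case x of (i, j, k) \<Rightarrow> \<lambda>v. v i j k) (\<lambda>i j k. real (u i j k))" by auto
      have sums: "?sums \<longleftrightarrow> (\<forall>j\<in>{1..r2}. \<forall>k\<in>{1..r1}.
          real r2 * (\<Sum>l\<in>?L1. real (plus_rows u j l))
          = real r1 * (\<Sum>l\<in>?L2. real (minus_rows u k l)))"
        by (simp only: of_nat_eq_iff flip: of_nat_sum of_nat_mult)
      have drop_coords: "(((A \<and> B) \<and> C) \<and> D) = (B \<and> C \<and> D)" if A for A B C D
        using that by blast
      show ?thesis
        unfolding semistandard_functionals_def ball_Un ball_simps(9) rows
          signed_functionals_nonneg_iff[of _ _ "\<lambda>v j. real r2 * sum (plus_rows v j) ?L1"
            "\<lambda>v k. real r1 * sum (minus_rows v k) ?L2"] sums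
        by (rule drop_coords[OF coords])
    qed
    also have "\<dots> \<longleftrightarrow> ?content"
    proof
      assume *: "?sums \<and> ?gaps"
      \<comment> \<open>Each row sum of \<open>plus_rows u\<close> is compared with that of row 1 of
        \<open>minus_rows u\<close>, and vice versa, so all row sums on one side agree. Positivity
        of \<open>r1\<close> and \<open>r2\<close> provides row 1 and allows cancellation.\<close>
      have one: "1 \<in> {1..r1}" "1 \<in> {1..r2}" using assms by auto
      have plus: "sum (plus_rows u j) ?L1 = sum (plus_rows u 1) ?L1" if "j \<in> {1..r2}" for j
      proof -
        have "r2 * sum (plus_rows u j) ?L1 = r2 * sum (plus_rows u 1) ?L1"
          using * that one by metis
        then show ?thesis using assms by simp
      qed
      have minus: "sum (minus_rows u k) ?L2 = sum (minus_rows u 1) ?L2" if "k \<in> {1..r1}" for k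
      proof -
        have "r1 * sum (minus_rows u k) ?L2 = r1 * sum (minus_rows u 1) ?L2"
          using * that one by metis
        then show ?thesis using assms by simp
      qed
      show ?content
      proof (intro exI conjI)
        show "sum (plus_rows u 1) ?L1 * r2 = sum (minus_rows u 1) ?L2 * r1"
          using * one by (metis mult.commute)
        show "semistandard_content ?L1 r2 (sum (plus_rows u 1) ?L1) (plus_rows u)"
          unfolding semistandard_content_def column_gap_nonneg_iff[symmetric]
          using * plus by (intro conjI ballI) (erule plus, blast)
        show "semistandard_content ?L2 r1 (sum (minus_rows u 1) ?L2) (minus_rows u)"
          unfolding semistandard_content_def column_gap_nonneg_iff[symmetric]
          using * minus by (intro conjI ballI) (erule minus, blast)
      qed
    next
      assume ?content
      then obtain w1 w2 where "w1 * r2 = w2 * r1" "semistandard_content ?L1 r2 w1 (plus_rows u)"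
        "semistandard_content ?L2 r1 w2 (minus_rows u)" by blast
      then show "?sums \<and> ?gaps"
        unfolding column_gap_nonneg_iff semistandard_content_def by (simp add: mult.commute)
    qed
    finally show ?thesis .
  qed
  show ?thesis
  proof (intro equalityI subsetI)
    fix v assume "v \<in> semistandard_vecs r1 r2 n"
    then show "v \<in> {v \<in> int_lattice r1 r2 n. \<forall>\<phi>\<in>semistandard_functionals r1 r2 n. 0 \<le> \<phi> v}"
      unfolding semistandard_vecs_iff[OF assms(1)] using nonneg_iff by (auto simp: int_lattice_def)
  next
    fix v assume "v \<in> {v \<in> int_lattice r1 r2 n. \<forall>\<phi>\<in>semistandard_functionals r1 r2 n. 0 \<le> \<phi> v}"
    then have v: "v \<in> int_lattice r1 r2 n"
      and pos: "\<And>\<phi>. \<phi> \<in> semistandard_functionals r1 r2 n \<Longrightarrow> 0 \<le> \<phi> v" by auto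
    have "0 \<le> v i j k" for i j k
    proof (cases "(i, j, k) \<in> index_set r1 r2 n")
      case True
      then show ?thesis
        using pos[of "\<lambda>v. v i j k"] coord_in_semistandard_functionals by blast
    next
      case False
      then show ?thesis using v by (simp add: int_lattice_def real_space_def)
    qed
    moreover have "v i j k \<in> \<int>" for i j k using v by (simp add: int_lattice_def)
    ultimately have "v i j k \<in> \<nat>" for i j k by (simp add: Nats_altdef2)
    then have "v i j k = real (nat \<lfloor>v i j k\<rfloor>)" for i j k by (metis Nats_cases floor_of_nat nat_int)
    then obtain u where "v = (\<lambda>i j k. real (u i j k))"
      by (intro that[of "\<lambda>i j k. nat \<lfloor>v i j k\<rfloor>"] ext)
    then show "v \<in> semistandard_vecs r1 r2 n"
      unfolding semistandard_vecs_iff[OF assms(1)]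
      using nonneg_iff[of u] pos v by (auto simp: int_lattice_def)
  qed
qed

theorem theorem3p4:
  fixes r1 r2 n :: nat
  assumes "0 < r1" and "0 < r2" and "0 < n"
  shows "finitely_generated_cone r1 r2 n (Cone (semistandard_vecs r1 r2 n)) \<and>
         Cone (semistandard_vecs r1 r2 n) \<inter> int_lattice r1 r2 n = semistandard_vecs r1 r2 n"
proof
  let ?S = "semistandard_vecs r1 r2 n" and ?M = "int_lattice r1 r2 n"
    and ?\<Phi> = "semistandard_functionals r1 r2 n"
  note S = semistandard_vecs_eq[OF assms(1,2), of n]
  note lin = semistandard_functionals_linear
  \<comment> \<open>Linearity with \<open>b = 1\<close> gives
    \<open>\<phi> 0 = \<phi> 0 + \<phi> 0\<close>.\<close>
  have zero: "\<phi> 0 = 0" if "\<phi> \<in> ?\<Phi>" for \<phi>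
    using lin[OF that, of 1 0 0] by (simp add: zero_fun_def)
  have diff: "\<phi> (u - v) = \<phi> u - \<phi> v" if "\<phi> \<in> ?\<Phi>" for \<phi> u v
    using lin[OF that, of "-1" v u] by (simp add: fun_diff_def)
  \<comment> \<open>The intersection of half-spaces is a convex cone containing \<open>?S\<close>,
    so it contains \<open>Cone ?S\<close>; lattice points of \<open>Cone ?S\<close> thus satisfy the
    inequalities that characterise \<open>?S\<close>.\<close>
  have "Cone ?S \<subseteq> {v. \<forall>\<phi>\<in>?\<Phi>. 0 \<le> \<phi> v}"
    by (rule Cone_subsetI) (auto simp: S zero lin)
  then show "Cone ?S \<inter> ?M = ?S" using Cone_superset[of ?S] S by auto

  have M_diff: "u - v \<in> ?M" if "u \<in> ?M" "v \<in> ?M" for u v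
    using that by (auto simp: int_lattice_def real_space_def fun_diff_def)
  have sep: "v = 0" if v: "v \<in> ?M" and "\<forall>\<phi>\<in>?\<Phi>. \<phi> v = 0" for v
  proof -
    have "v i j k = 0" for i j k
    proof (cases "(i, j, k) \<in> index_set r1 r2 n")
      case True
      then show ?thesis
        using bspec[OF that(2) coord_in_semistandard_functionals] by simp
    next
      case False
      then show ?thesis using v by (simp add: int_lattice_def real_space_def)
    qed
    then show ?thesis by (simp add: zero_fun_def fun_eq_iff)
  qed
  have "\<exists>F. finite F \<and> F \<subseteq> ?S \<and>
    (\<forall>A. F \<subseteq> A \<longrightarrow> 0 \<in> A \<longrightarrow> (\<forall>u\<in>A. \<forall>v\<in>A. u + v \<in> A) \<longrightarrow> ?S \<subseteq> A)"
    unfolding S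
  proof (rule finite_Hilbert_basis)
    show "finite ?\<Phi>" by (rule finite_semistandard_functionals)
    show "\<phi> v \<in> \<int>" if "\<phi> \<in> ?\<Phi>" "v \<in> ?M" for \<phi> v
      using that by (rule semistandard_functionals_Ints)
    show "u - v \<in> ?M" if "u \<in> ?M" "v \<in> ?M" for u v
      using that by (rule M_diff)
    show "\<phi> (u - v) = \<phi> u - \<phi> v" if "\<phi> \<in> ?\<Phi>" for \<phi> u v
      using that by (rule diff)
    show "v = 0" if "v \<in> ?M" "\<forall>\<phi>\<in>?\<Phi>. \<phi> v = 0" for v
      using that by (rule sep)
  qed
  then obtain F where F: "finite F" "F \<subseteq> ?S"
    and basis: "\<forall>A. F \<subseteq> A \<longrightarrow> 0 \<in> A \<longrightarrow> (\<forall>u\<in>A. \<forall>v\<in>A. u + v \<in> A) \<longrightarrow> ?S \<subseteq> A"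
    by (elim exE conjE)
  \<comment> \<open>Closure under addition allows \<open>A = Cone F\<close> in the generation
    property of \<open>F\<close>.\<close>
  have "u + v \<in> Cone F" if "u \<in> Cone F" "v \<in> Cone F" for u v
    using Cone_finite_lincomb[OF F(1) _ that, of 1] by (simp add: plus_fun_def)
  then have "?S \<subseteq> Cone F" using spec[OF basis, of "Cone F"] Cone_superset[of F] zero_in_Cone[of F] by simp
  then have "Cone ?S \<subseteq> Cone F"
    by (rule Cone_subsetI) (simp_all add: zero_in_Cone Cone_finite_lincomb F(1))
  moreover have "Cone F \<subseteq> Cone ?S" using F(2) unfolding Cone_def by blast
  moreover have "F \<subseteq> real_space r1 r2 n" using F(2) S by (auto simp: int_lattice_def)
  ultimately show "finitely_generated_cone r1 r2 n (Cone ?S)"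
    unfolding finitely_generated_cone_def using F(1) by blast
qed

end
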